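(* Let $p$ be a prime, let $m\ge 0$ be an integer, and let $f:\mathbb{Z}_p\to\mathbb{Z}_p$ be an analytic function of level $m$. Then $f$ is an arithmetic differential operator of order $m$.
   Context: $\mathbb{Z}_p$ denotes the ring of $p$-adic integers with the $p$-adic norm $|\cdot|_p$, $|p|_p=p^{-1}$. The Fermat quotient operator is $\delta:\mathbb{Z}_p\to\mathbb{Z}_p$, $\delta a=(a-a^p)/p$, and $\delta^i$ denotes its $i$-th iterate. A power series $F=\sum_{\alpha} a_\alpha x^\alpha\in\mathbb{Z}_p[[x_0,\dots,x_k]]$ is called restricted if $a_\alpha\to 0$ $p$-adically as $|\alpha|=\alpha_0+\dots+\alpha_k\to\infty$. A function $f:\mathbb{Z}_p\to\mathbb{Z}_p$ is an arithmetic differential operator of order $m$ if there is a restricted power series $F\in\mathbb{Z}_p[[x_0,\dots,x_m]]$ with $f(a)=F(a,\delta a,\dots,\delta^m a)$ for all $a\in\mathbb{Z}_p$. A function $f:\mathbb{Z}_p\to\mathbb{Z}_p$ is analytic of level $m$ if for every $a\in\mathbb{Z}_p$ there is a restricted power series $F_a\in\mathbb{Z}_p[[x]]$ (one variable) such that $f(a+p^m u)=F_a(u)$ for all $u\in\mathbb{Z}_p$. *)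

theory Defs
  imports "HOL-Computational_Algebra.Primes"
begin

text \<open>p-adic integers Z_p, represented as coherent sequences of residues:
  x n is the residue of x modulo p^n, in {0..<p^n}.\<close>

definition zp :: "int \<Rightarrow> (nat \<Rightarrow> int) set" where
  "zp p = {x. \<forall>n. 0 \<le> x n \<and> x n < p ^ n \<and> x n = x (Suc n) mod p ^ n}"

definition zof :: "int \<Rightarrow> int \<Rightarrow> (nat \<Rightarrow> int)" where
  "zof p k = (\<lambda>n. k mod p ^ n)"

definition zadd :: "int \<Rightarrow> (nat \<Rightarrow> int) \<Rightarrow> (nat \<Rightarrow> int) \<Rightarrow> (nat \<Rightarrow> int)" where
  "zadd p x y = (\<lambda>n. (x n + y n) mod p ^ n)"

definition zsub :: "int \<Rightarrow> (nat \<Rightarrow> int) \<Rightarrow> (nat \<Rightarrow> int) \<Rightarrow> (nat \<Rightarrow> int)" where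
  "zsub p x y = (\<lambda>n. (x n - y n) mod p ^ n)"

definition zmul :: "int \<Rightarrow> (nat \<Rightarrow> int) \<Rightarrow> (nat \<Rightarrow> int) \<Rightarrow> (nat \<Rightarrow> int)" where
  "zmul p x y = (\<lambda>n. (x n * y n) mod p ^ n)"

definition zpow :: "int \<Rightarrow> (nat \<Rightarrow> int) \<Rightarrow> nat \<Rightarrow> (nat \<Rightarrow> int)" where
  "zpow p x k = (\<lambda>n. (x n ^ k) mod p ^ n)"

definition fdelta :: "int \<Rightarrow> (nat \<Rightarrow> int) \<Rightarrow> (nat \<Rightarrow> int)" where
  "fdelta p a = (THE c. c \<in> zp p \<and> zmul p (zof p p) c = zsub p a (zpow p a (nat p)))"

definition MI :: "nat \<Rightarrow> (nat \<Rightarrow> nat) set" where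
  "MI k = {\<alpha>. \<forall>i>k. \<alpha> i = 0}"

text \<open>Restricted power series in Z_p[[x_0,...,x_k]]: coefficients in Z_p tending to 0
  p-adically as |alpha| \<rightarrow> \<infinity> (i.e. for each N, p^N divides a_alpha once |alpha| is large).\<close>
definition restricted :: "int \<Rightarrow> nat \<Rightarrow> ((nat \<Rightarrow> nat) \<Rightarrow> (nat \<Rightarrow> int)) \<Rightarrow> bool" where
  "restricted p k a \<longleftrightarrow> (\<forall>\<alpha>\<in>MI k. a \<alpha> \<in> zp p) \<and>
     (\<forall>N. \<exists>D. \<forall>\<alpha>\<in>MI k. (\<Sum>i\<le>k. \<alpha> i) \<ge> D \<longrightarrow> a \<alpha> N = 0)"

text \<open>Value of a restricted power series at (x_0,...,x_k) in Z_p^(k+1): the p-adic limit of the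
  partial sums; modulo p^N it equals the finite sum over the alpha with a_alpha not divisible by p^N.\<close>
definition ps_eval :: "int \<Rightarrow> nat \<Rightarrow> ((nat \<Rightarrow> nat) \<Rightarrow> (nat \<Rightarrow> int)) \<Rightarrow> (nat \<Rightarrow> nat \<Rightarrow> int) \<Rightarrow> (nat \<Rightarrow> int)" where
  "ps_eval p k a x = (\<lambda>N. (\<Sum>\<alpha> \<in> {\<alpha>\<in>MI k. a \<alpha> N \<noteq> 0}. a \<alpha> N * (\<Prod>i\<le>k. x i N ^ \<alpha> i)) mod p ^ N)"

definition arith_diff_op :: "int \<Rightarrow> nat \<Rightarrow> ((nat \<Rightarrow> int) \<Rightarrow> (nat \<Rightarrow> int)) \<Rightarrow> bool" where
  "arith_diff_op p m f \<longleftrightarrow> (\<exists>F. restricted p m F \<and>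
     (\<forall>a\<in>zp p. f a = ps_eval p m F (\<lambda>i. (fdelta p ^^ i) a)))"

definition analytic_level :: "int \<Rightarrow> nat \<Rightarrow> ((nat \<Rightarrow> int) \<Rightarrow> (nat \<Rightarrow> int)) \<Rightarrow> bool" where
  "analytic_level p m f \<longleftrightarrow> (\<forall>a\<in>zp p. \<exists>F. restricted p 0 F \<and>
     (\<forall>u\<in>zp p. f (zadd p a (zmul p (zpow p (zof p p) m) u)) = ps_eval p 0 F (\<lambda>_. u)))"

end

theory Submission
  imports Defs "HOL-Number_Theory.Residues" "HOL-Computational_Algebra.Polynomial"
begin

text \<open>As a polynomial in \<open>z\<close>, \<open>\<delta>\<^sup>i (x + p\<^sup>m z)\<close> is \<open>\<delta>\<^sup>i x + p\<^bsup>m-i\<^esup> (z + p G\<^sub>i(z))\<close> for every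
  \<open>i \<le> m\<close>, with \<open>G\<^sub>i\<close> integral. Hence modulo \<open>p\<close> the functions \<open>\<delta>\<^sup>i\<close> with \<open>i < m\<close> are constant
  on each ball of radius \<open>p\<^bsup>-m\<^esup>\<close> and together separate these balls, while \<open>\<delta>\<^sup>m\<close> is a
  coordinate on each of them. So any family of polynomials on the \<open>p\<^sup>m\<close> balls agrees, modulo
  \<open>p\<close> and coefficient by coefficient, with one polynomial in \<open>x, \<delta> x, \<dots>, \<delta>\<^sup>m x\<close>; dividing
  the error by \<open>p\<close> and repeating yields a convergent series of polynomials. Coefficientwise
  agreement matters: a polynomial such as \<open>z\<^sup>p - z\<close> has all its values divisible by \<open>p\<close>.
  Since everything is tested modulo \<open>p\<^sup>N\<close>, polynomials over the integers suffice.\<close>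

section \<open>Congruences for powers, products and compositions\<close>

text \<open>Modulo \<open>x - y\<close> the cofactor of \<open>x - y\<close> in
  \<open>x ^ n - y ^ n\<close> is \<open>n * y ^ (n - 1)\<close>, and \<open>n\<close> divides
  \<open>d\<close>, hence \<open>x - y\<close>. For \<open>n = p\<close>, taking powers gains a
  factor \<open>p\<close>.\<close>

lemma power_diff_dvd:
  fixes x y d :: "'a::comm_ring_1"
  assumes d: "d dvd x - y" and n: "of_nat n dvd d"
  shows "d * of_nat n dvd x ^ n - y ^ n"
proof -
  have "x ^ n - y ^ n = (x - y) * (\<Sum>i<n. y ^ (n - Suc i) * x ^ i)"
    by (rule power_diff_sumr2)
  moreover have "of_nat n dvd (\<Sum>i<n. y ^ (n - Suc i) * x ^ i)"
  proof -
    have pw: "x - y dvd x ^ k - y ^ k" for k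
      using power_diff_sumr2[of x k y] by simp
    have "x - y dvd y ^ (n - Suc i) * x ^ i - y ^ (n - 1)" if "i < n" for i
    proof -
      have "y ^ (n - 1) = y ^ (n - Suc i) * y ^ i"
        using that by (simp flip: power_add)
      then show ?thesis
        using pw[of i] by (simp flip: right_diff_distrib)
    qed
    then have "x - y dvd (\<Sum>i<n. y ^ (n - Suc i) * x ^ i - y ^ (n - 1))"
      by (intro dvd_sum) auto
    moreover have "of_nat n dvd x - y"
      using d n by (rule dvd_trans[rotated])
    ultimately have "of_nat n dvd (\<Sum>i<n. y ^ (n - Suc i) * x ^ i) - of_nat n * y ^ (n - 1)"
      by (simp add: sum_subtractf) (meson dvd_trans)
    then show ?thesis
      by (simp add: dvd_diff_left_iff)
  qed
  ultimately show ?thesis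
    using d by (simp add: mult_dvd_mono)
qed

lemma prod_dvd_diff:
  fixes f g :: "'b \<Rightarrow> 'a::comm_ring_1"
  assumes "\<And>i. i \<in> A \<Longrightarrow> d dvd f i - g i"
  shows "d dvd prod f A - prod g A"
  using assms
proof (induction A rule: infinite_finite_induct)
  case (insert i A)
  have "prod f (insert i A) - prod g (insert i A)
      = (f i - g i) * prod f A + g i * (prod f A - prod g A)"
    using insert.hyps by (simp add: algebra_simps)
  with insert show ?case
    by simp
qed auto

lemma power_dvd_diff:
  fixes x y :: "'a::comm_ring_1"
  assumes "d dvd x - y"
  shows "d dvd x ^ n - y ^ n"
  using prod_dvd_diff[of "{..<n}" d "\<lambda>_. x" "\<lambda>_. y"] assms by simp

lemma pcompose_dvd_diff:
  fixes x y d :: "'a::comm_ring_1 poly"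
  assumes "d dvd x - y"
  shows "d dvd pcompose P x - pcompose P y"
proof (induction P)
  case (pCons c P)
  have "pcompose (pCons c P) x - pcompose (pCons c P) y
      = (x - y) * pcompose P x + y * (pcompose P x - pcompose P y)"
    by (simp add: pcompose_pCons algebra_simps)
  with assms pCons show ?case
    by simp
qed simp

lemma poly_dvd_of_int:
  assumes "of_int c dvd (P :: int poly)"
  shows "c dvd poly P z"
proof -
  from assms obtain Q where "P = of_int c * Q" ..
  then have "poly P z = c * poly Q z"
    by simp
  then show ?thesis
    by simp
qed

section \<open>The Fermat quotient on ordinary integers\<close>

lemma fermat_int:
  fixes p x :: int
  assumes "prime p" "\<not> p dvd x"
  shows "p dvd 1 - x ^ (nat p - 1)"
proof -
  have p: "p > 0"
    using assms prime_gt_0_int by blast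
  define y where "y = nat (x mod p)"
  have y: "int y = x mod p"
    using p by (simp add: y_def)
  have "\<not> nat p dvd y"
    using assms p y by (metis dvd_mod_iff dvd_refl int_dvd_int_iff int_nat_eq less_imp_le)
  moreover have "prime (nat p)"
    using assms by simp
  ultimately have "[y ^ (nat p - 1) = 1] (mod nat p)"
    by (intro fermat_theorem)
  then have "[int y ^ (nat p - 1) = 1] (mod p)"
    using p by (metis cong_int_iff int_nat_eq less_imp_le of_nat_1 of_nat_power)
  moreover have "[int y ^ (nat p - 1) = x ^ (nat p - 1)] (mod p)"
    by (intro cong_pow) (simp add: y cong_def)
  ultimately have "[1 = x ^ (nat p - 1)] (mod p)"
    using cong_trans cong_sym by blast
  then show ?thesis
    by (simp add: cong_iff_dvd_diff)
qed

lemma fermat_int_self: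
  fixes p x :: int
  assumes "prime p"
  shows "p dvd x - x ^ nat p"
proof (cases "p dvd x")
  case True
  moreover have "nat p > 0"
    using assms prime_gt_0_int by simp
  ultimately show ?thesis
    by (meson dvd_diff dvd_power dvd_trans)
next
  case False
  have "nat p = Suc (nat p - 1)"
    using assms prime_gt_0_int[of p] by simp
  then have "x - x ^ nat p = x * (1 - x ^ (nat p - 1))"
    by (metis mult.right_neutral power_Suc right_diff_distrib)
  with fermat_int[OF assms False] show ?thesis
    by simp
qed

text \<open>For prime \<open>p\<close> the division is exact by \<open>fermat_int_self\<close>.
  Working on integers turns statements about delta into congruences between values of integer
  polynomials.\<close>

definition idelta :: "int \<Rightarrow> int \<Rightarrow> int" where
  "idelta p x = (x - x ^ nat p) div p"

lemma mult_idelta: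
  assumes "prime p"
  shows "p * idelta p x = x - x ^ nat p"
  using fermat_int_self[OF assms] by (simp add: idelta_def)

text \<open>The numerator \<open>x - x ^ nat p\<close> preserves congruences; dividing by
  \<open>p\<close> costs one power of \<open>p\<close>.\<close>

lemma idelta_dvd_diff:
  assumes p: "prime p" and xy: "p ^ Suc N dvd x - y"
  shows "p ^ N dvd idelta p x - idelta p y"
proof -
  have "p ^ Suc N dvd (x - y) - (x ^ nat p - y ^ nat p)"
    using xy power_dvd_diff[OF xy] by (rule dvd_diff)
  also have "\<dots> = p * (idelta p x - idelta p y)"
    using mult_idelta[OF p] by (simp add: right_diff_distrib)
  finally show ?thesis
    using p by auto
qed

section \<open>Residue sequences and delta on them\<close>

lemma zp_D:
  assumes "a \<in> zp p"
  shows "0 \<le> a N \<and> a N < p ^ N \<and> a N = a (Suc N) mod p ^ N"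
  using assms unfolding zp_def mem_Collect_eq by (rule spec)

lemma zpI:
  assumes "\<And>N. 0 \<le> a N \<and> a N < p ^ N" "\<And>N. a N = a (Suc N) mod p ^ N"
  shows "a \<in> zp p"
  unfolding zp_def mem_Collect_eq using assms by blast

lemma zp_Suc:
  assumes "a \<in> zp p"
  shows "a (Suc N) mod p ^ N = a N"
  using zp_D[OF assms, of N] by (elim conjE) (rule sym)

lemma zp_range:
  assumes "a \<in> zp p"
  shows "0 \<le> a N" "a N < p ^ N"
  by (rule zp_D[OF assms, THEN conjunct1], rule zp_D[OF assms, THEN conjunct2, THEN conjunct1])

lemma zp_mod:
  assumes "a \<in> zp p"
  shows "a (N + k) mod p ^ N = a N"
proof (induction k)
  case 0
  show ?case using zp_Suc[OF assms] by (metis add_0_right mod_mod_trivial)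
next
  case (Suc k)
  have "a (N + Suc k) mod p ^ N = (a (N + Suc k) mod p ^ (N + k)) mod p ^ N"
    by (simp add: mod_mod_cancel power_add)
  also have "a (N + Suc k) mod p ^ (N + k) = a (N + k)"
    using zp_Suc[OF assms, of "N + k"] by simp
  finally show ?case using Suc by simp
qed

lemma zp_dvd_diff:
  assumes "a \<in> zp p"
  shows "p ^ N dvd a (N + k) - a N"
  using dvd_minus_mod[of "p ^ N" "a (N + k)"] unfolding zp_mod[OF assms] .

text \<open>Resolves the definite description in \<open>fdelta\<close>. Division by \<open>p\<close>
  uses up one digit, so level \<open>N\<close> of the quotient is read from level
  \<open>Suc N\<close> of \<open>a\<close>.\<close>

lemma fdelta_zp:
  assumes p: "prime p" and a: "a \<in> zp p"
  shows "fdelta p a \<in> zp p \<and> fdelta p a = (\<lambda>N. idelta p (a (Suc N)) mod p ^ N)"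
proof -
  have pos: "p > 0"
    using p prime_gt_0_int by blast
  define c where "c = (\<lambda>N. idelta p (a (Suc N)) mod p ^ N)"
  have "c N = c (Suc N) mod p ^ N" for N
  proof -
    have "p ^ N dvd idelta p (a (Suc (Suc N))) - idelta p (a (Suc N))"
      using idelta_dvd_diff[OF p] zp_dvd_diff[OF a, of "Suc N" 1] by simp
    then have "idelta p (a (Suc N)) mod p ^ N = idelta p (a (Suc (Suc N))) mod p ^ N"
      by (metis mod_eq_dvd_iff)
    then show ?thesis
      by (simp add: c_def mod_mod_cancel)
  qed
  moreover have "0 \<le> c N \<and> c N < p ^ N" for N
    using pos by (simp add: c_def)
  ultimately have c_zp: "c \<in> zp p"
    unfolding zp_def by blast
  have eqn: "zmul p (zof p p) d = zsub p a (zpow p a (nat p)) \<longleftrightarrow>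
      (\<forall>N. p ^ N dvd p * (d N) - (a N - a N ^ nat p))" for d
    by (simp add: zmul_def zof_def zsub_def zpow_def fun_eq_iff mod_simps mod_eq_dvd_iff)
  have "p ^ N dvd p * c N - (a N - a N ^ nat p)" for N
  proof -
    have "p ^ N dvd a (Suc N) - a N"
      using zp_dvd_diff[OF a, of N 1] by simp
    then have "p ^ N dvd (a (Suc N) - a N) - (a (Suc N) ^ nat p - a N ^ nat p)"
      using power_dvd_diff by (blast intro: dvd_diff)
    moreover have "p ^ N dvd p * (c N - idelta p (a (Suc N)))"
      unfolding c_def by (rule dvd_mult) (metis mod_eq_dvd_iff mod_mod_trivial)
    ultimately have "p ^ N dvd p * (c N - idelta p (a (Suc N)))
        + ((a (Suc N) - a N) - (a (Suc N) ^ nat p - a N ^ nat p))"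
      by (intro dvd_add)
    then show ?thesis
      using mult_idelta[OF p, of "a (Suc N)"] by (simp add: algebra_simps)
  qed
  then have c_eq: "zmul p (zof p p) c = zsub p a (zpow p a (nat p))"
    using eqn by simp
  have uniq: "d = c" if d: "d \<in> zp p" "zmul p (zof p p) d = zsub p a (zpow p a (nat p))" for d
  proof
    fix N
    \<comment> \<open>The equation is read at level \<open>Suc N\<close>, where cancelling
      \<open>p\<close> still leaves a congruence modulo \<open>p ^ N\<close>.\<close>
    have "p ^ Suc N dvd p * d (Suc N) - (a (Suc N) - a (Suc N) ^ nat p)"
      using d eqn by blast
    also have "\<dots> = p * (d (Suc N) - idelta p (a (Suc N)))"
      using mult_idelta[OF p, of "a (Suc N)"] by (simp add: algebra_simps)
    finally have "p ^ N dvd d (Suc N) - idelta p (a (Suc N))"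
      using pos by simp
    then have "d (Suc N) mod p ^ N = c N"
      by (simp add: c_def mod_eq_dvd_iff)
    then show "d N = c N"
      using zp_Suc[OF d(1)] by simp
  qed
  have "fdelta p a = c"
    unfolding fdelta_def
    by (rule the_equality) (rule conjI[OF c_zp c_eq], erule conjE, rule uniq)
  then show ?thesis
    using c_zp by (simp add: c_def)
qed

text \<open>Each application of delta uses up one digit, which accounts for the argument
  \<open>a (N + i)\<close>.\<close>

lemma fdelta_funpow:
  assumes p: "prime p" and a: "a \<in> zp p"
  shows "(fdelta p ^^ i) a \<in> zp p \<and> p ^ N dvd (fdelta p ^^ i) a N - (idelta p ^^ i) (a (N + i))"
proof (induction i arbitrary: N)
  case (Suc i)
  let ?b = "(fdelta p ^^ i) a"
  have b: "?b \<in> zp p" and "p ^ Suc N dvd ?b (Suc N) - (idelta p ^^ i) (a (Suc N + i))"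
    using Suc by blast+
  then have "p ^ N dvd idelta p (?b (Suc N)) - (idelta p ^^ Suc i) (a (N + Suc i))"
    using idelta_dvd_diff[OF p] by simp
  moreover have "p ^ N dvd fdelta p ?b N - idelta p (?b (Suc N))"
    using fdelta_zp[OF p b] by (simp flip: mod_eq_dvd_iff)
  ultimately have "p ^ N dvd (fdelta p ?b N - idelta p (?b (Suc N)))
      + (idelta p (?b (Suc N)) - (idelta p ^^ Suc i) (a (N + Suc i)))"
    by (rule dvd_add[rotated])
  then have "p ^ N dvd fdelta p ?b N - (idelta p ^^ Suc i) (a (N + Suc i))"
    by simp
  then show ?case
    using fdelta_zp[OF p b] unfolding funpow.simps comp_apply by blast
qed (use a in simp)

section \<open>Iterates of delta on a ball\<close>

lemma idelta_funpow_dvd_diff: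
  assumes p: "prime p" and "p ^ (N + i) dvd x - y"
  shows "p ^ N dvd (idelta p ^^ i) x - (idelta p ^^ i) y"
  using assms(2)
proof (induction i arbitrary: N)
  case (Suc i)
  from Suc.IH[of "Suc N"] Suc.prems show ?case
    using idelta_dvd_diff[OF p] by simp
qed simp

text \<open>Induction on \<open>i\<close>. For \<open>i < m\<close>, \<open>Y ^ nat p\<close> is
  constant modulo \<open>p ^ (m - i) * p\<close> by \<open>power_diff_dvd\<close>. Dividing
  \<open>Y - Y ^ nat p\<close> by \<open>p\<close> thus lowers the power of \<open>p\<close> before
  the linear term by one, and the \<open>p\<close>-th power enters only the constant and
  \<open>G\<close>.\<close>

lemma idelta_poly:
  assumes p: "prime p"
  shows "i \<le> m \<Longrightarrow> \<exists>Y G. (\<forall>z. poly Y z = (idelta p ^^ i) (x + p ^ m * z)) \<and>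
    Y = of_int ((idelta p ^^ i) x) + of_int (p ^ (m - i)) * ([:0, 1:] + of_int p * G)"
proof (induction i)
  case 0
  show ?case
    by (rule exI[of _ "of_int x + of_int (p ^ m) * [:0, 1:]"], rule exI[of _ 0]) simp
next
  case (Suc i)
  let ?x = "(idelta p ^^ i) x" and ?U = "[:0, 1:] :: int poly"
  have pos: "p > 0"
    using p prime_gt_0_int by blast
  obtain Y G where Y: "\<And>z. poly Y z = (idelta p ^^ i) (x + p ^ m * z)"
    and YG: "Y = of_int ?x + of_int (p ^ (m - i)) * (?U + of_int p * G)"
    using Suc.IH[OF Suc_leD[OF Suc.prems]] by blast
  define j where "j = m - Suc i"
  have j: "m - i = Suc j"
    using Suc.prems by (simp add: j_def)
  have nat_p: "of_nat (nat p) = (of_int p :: int poly)"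
    using pos by simp
  \<comment> \<open>The modulus \<open>p ^ Suc j\<close> is itself divisible by \<open>p\<close>
    because \<open>i < m\<close>.\<close>
  have "of_int (p ^ Suc j) * of_nat (nat p) dvd Y ^ nat p - of_int ?x ^ nat p"
    by (rule power_diff_dvd) (auto simp: YG j nat_p)
  then obtain K where K: "Y ^ nat p - of_int ?x ^ nat p = of_int (p ^ Suc j) * of_int p * K"
    unfolding nat_p ..
  define Y' where "Y' = of_int (idelta p ?x) + of_int (p ^ j) * (?U + of_int p * (G - K))"
  have "Y - Y ^ nat p = of_int (?x - ?x ^ nat p)
      + of_int (p ^ Suc j) * (?U + of_int p * G) - of_int (p ^ Suc j) * of_int p * K"
    using K by (simp add: YG[unfolded j] algebra_simps)
  also have "\<dots> = of_int p * Y'"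
    by (simp add: Y'_def flip: mult_idelta[OF p]) (simp add: algebra_simps)
  finally have *: "of_int p * Y' = Y - Y ^ nat p" ..
  have "poly Y' z = (idelta p ^^ Suc i) (x + p ^ m * z)" for z
  proof -
    have "p * poly Y' z = poly Y z - poly Y z ^ nat p"
      using arg_cong[OF *, of "\<lambda>P. poly P z"] by simp
    then show ?thesis
      using pos mult_idelta[OF p] by (simp add: Y) (metis mult_cancel_left less_irrefl)
  qed
  then show ?case
    unfolding j_def[symmetric] by (intro exI[of _ Y'] exI[of _ "G - K"]) (simp add: Y'_def)
qed

text \<open>Once \<open>p ^ m\<close> divides \<open>x - y\<close>, write
  \<open>x = y + p ^ m * z\<close>. By \<open>idelta_poly\<close> at \<open>i = m\<close> the
  \<open>m\<close>-th iterates differ by \<open>z\<close> modulo \<open>p\<close>, so their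
  agreement gives one more factor \<open>p\<close>.\<close>

lemma idelta_digits:
  assumes p: "prime p" and eq: "\<And>i. i < m \<Longrightarrow> p dvd (idelta p ^^ i) x - (idelta p ^^ i) y"
  shows "p ^ m dvd x - y"
  using eq
proof (induction m)
  case (Suc m)
  then have "p ^ m dvd x - y"
    by simp
  then obtain z where "x - y = p ^ m * z" ..
  then have z: "x = y + p ^ m * z"
    by simp
  obtain Y G where Y: "\<And>z. poly Y z = (idelta p ^^ m) (y + p ^ m * z)"
    and G: "Y = of_int ((idelta p ^^ m) y) + of_int (p ^ (m - m)) * ([:0, 1:] + of_int p * G)"
    using idelta_poly[OF p, of m m y] by blast
  have "(idelta p ^^ m) x - (idelta p ^^ m) y = z + p * poly G z"
    unfolding z by (simp flip: Y) (simp add: G)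
  then have "p dvd z"
    using Suc.prems[of m] by (metis dvd_add_left_iff dvd_triv_left lessI)
  then show ?case
    by (simp add: z)
qed simp


lemma idelta_digits_eq:
  assumes p: "prime p" and eq: "\<And>i. i < m \<Longrightarrow> p dvd (idelta p ^^ i) x - (idelta p ^^ i) y"
    and "x \<in> {0..<p ^ m}" "y \<in> {0..<p ^ m}"
  shows "x = y"
proof -
  have "p ^ m dvd x - y"
    using idelta_digits[OF p] eq by blast
  then have "x mod p ^ m = y mod p ^ m"
    by (simp add: mod_eq_dvd_iff)
  with assms(3,4) show ?thesis
    by simp
qed

section \<open>Multivariate polynomials over the integers\<close>

definition msupp :: "nat \<Rightarrow> ((nat \<Rightarrow> nat) \<Rightarrow> int) \<Rightarrow> bool" where
  "msupp m H \<longleftrightarrow> finite {\<alpha>. H \<alpha> \<noteq> 0} \<and> {\<alpha>. H \<alpha> \<noteq> 0} \<subseteq> MI m"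

text \<open>The ring of values is left open, so that one coefficient family \<open>H\<close> can be
  evaluated both at integers and at polynomials in \<open>z\<close>; the latter is what compares
  coefficients.\<close>

definition meval :: "nat \<Rightarrow> ((nat \<Rightarrow> nat) \<Rightarrow> int) \<Rightarrow> (nat \<Rightarrow> 'a::comm_ring_1) \<Rightarrow> 'a" where
  "meval m H X = (\<Sum>\<alpha> | H \<alpha> \<noteq> 0. of_int (H \<alpha>) * (\<Prod>i\<le>m. X i ^ \<alpha> i))"

text \<open>Reduces the construction in \<open>mpoly_fun_mod_p\<close> to closure properties, with
  no explicit coefficients there.\<close>

definition mpoly_fun :: "nat \<Rightarrow> ((nat \<Rightarrow> 'a::comm_ring_1) \<Rightarrow> 'a) \<Rightarrow> bool" where
  "mpoly_fun m G \<longleftrightarrow> (\<exists>H. msupp m H \<and> G = meval m H)"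

lemma meval_superset:
  assumes "finite A" "{\<alpha>. H \<alpha> \<noteq> 0} \<subseteq> A"
  shows "meval m H X = (\<Sum>\<alpha>\<in>A. of_int (H \<alpha>) * (\<Prod>i\<le>m. X i ^ \<alpha> i))"
  unfolding meval_def using assms by (intro sum.mono_neutral_left) auto

lemma msupp_lin:
  assumes "msupp m H" "msupp m H'"
  shows "msupp m (\<lambda>\<alpha>. H \<alpha> + c * H' \<alpha>)"
proof -
  have "{\<alpha>. H \<alpha> + c * H' \<alpha> \<noteq> 0} \<subseteq> {\<alpha>. H \<alpha> \<noteq> 0} \<union> {\<alpha>. H' \<alpha> \<noteq> 0}"
    by auto
  with assms show ?thesis
    unfolding msupp_def by (meson finite_UnI finite_subset le_sup_iff order_trans)
qed

lemma meval_lin: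
  assumes "msupp m H" "msupp m H'"
  shows "meval m (\<lambda>\<alpha>. H \<alpha> + c * H' \<alpha>) X = meval m H X + of_int c * meval m H' X"
proof -
  define A where "A = {\<alpha>. H \<alpha> \<noteq> 0} \<union> {\<alpha>. H' \<alpha> \<noteq> 0}"
  have "finite A"
    using assms by (simp add: A_def msupp_def)
  note sup = meval_superset[OF this]
  have "meval m (\<lambda>\<alpha>. H \<alpha> + c * H' \<alpha>) X
      = (\<Sum>\<alpha>\<in>A. of_int (H \<alpha> + c * H' \<alpha>) * (\<Prod>i\<le>m. X i ^ \<alpha> i))"
    by (rule sup) (auto simp: A_def)
  also have "\<dots> = (\<Sum>\<alpha>\<in>A. of_int (H \<alpha>) * (\<Prod>i\<le>m. X i ^ \<alpha> i))
      + of_int c * (\<Sum>\<alpha>\<in>A. of_int (H' \<alpha>) * (\<Prod>i\<le>m. X i ^ \<alpha> i))"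
    by (simp add: sum.distrib sum_distrib_left algebra_simps)
  also have "\<dots> = meval m H X + of_int c * meval m H' X"
    using sup[of H m X] sup[of H' m X] by (simp add: A_def)
  finally show ?thesis .
qed

lemma mpoly_fun_add:
  assumes "mpoly_fun m F" "mpoly_fun m G"
  shows "mpoly_fun m (\<lambda>X. F X + G X)"
proof -
  obtain H H' where "msupp m H" "F = meval m H" "msupp m H'" "G = meval m H'"
    using assms unfolding mpoly_fun_def by blast
  moreover from this have "(\<lambda>X. F X + G X) = meval m (\<lambda>\<alpha>. H \<alpha> + 1 * H' \<alpha>)"
    by (intro ext, subst meval_lin) auto
  ultimately show ?thesis
    unfolding mpoly_fun_def using msupp_lin by blast
qed

lemma mpoly_fun_monomial:
  assumes "\<gamma> \<in> MI m"
  shows "mpoly_fun m (\<lambda>X :: nat \<Rightarrow> 'a::comm_ring_1. of_int c * (\<Prod>i\<le>m. X i ^ \<gamma> i))"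
proof -
  define H where "H = (\<lambda>\<alpha>. if \<alpha> = \<gamma> then c else 0)"
  have sub: "{\<alpha>. H \<alpha> \<noteq> 0} \<subseteq> {\<gamma>}"
    by (auto simp: H_def)
  then have "msupp m H"
    using assms finite_subset[OF sub] by (auto simp: msupp_def)
  moreover have "meval m H = (\<lambda>X :: nat \<Rightarrow> 'a. of_int c * (\<Prod>i\<le>m. X i ^ \<gamma> i))"
    using meval_superset[OF _ sub] by (auto simp: H_def fun_eq_iff)
  ultimately show ?thesis
    unfolding mpoly_fun_def by (intro exI[of _ H]) simp
qed

lemma mpoly_fun_const: "mpoly_fun m (\<lambda>X. of_int c)"
  using mpoly_fun_monomial[of "\<lambda>_. 0" m c] by (simp add: MI_def)

lemma mpoly_fun_sum:
  assumes "\<And>b. b \<in> B \<Longrightarrow> mpoly_fun m (F b)"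
  shows "mpoly_fun m (\<lambda>X. \<Sum>b\<in>B. F b X)"
  using assms
proof (induction B rule: infinite_finite_induct)
  case (insert b B)
  then show ?case
    using mpoly_fun_add[of m "F b"] by simp
qed (use mpoly_fun_const[of m 0] in simp_all)

lemma mpoly_fun_var:
  assumes "j \<le> m"
  shows "mpoly_fun m (\<lambda>X. X j)"
proof -
  have "(\<Prod>i\<le>m. X i ^ (if i = j then 1 else 0)) = X j" for X :: "nat \<Rightarrow> 'a"
  proof -
    have "(\<Prod>i\<le>m. X i ^ (if i = j then 1 else 0)) = (\<Prod>i\<le>m. if i = j then X i else 1)"
      by (rule prod.cong) auto
    then show ?thesis
      using assms by simp
  qed
  moreover have "mpoly_fun m (\<lambda>X :: nat \<Rightarrow> 'a. of_int 1 * (\<Prod>i\<le>m. X i ^ (if i = j then 1 else 0)))"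
    using assms by (intro mpoly_fun_monomial) (simp add: MI_def)
  ultimately show ?thesis
    by (simp only: of_int_1 mult_1_left)
qed

lemma mpoly_fun_mult:
  assumes "mpoly_fun m F" "mpoly_fun m G"
  shows "mpoly_fun m (\<lambda>X. F X * G X)"
proof -
  obtain H H' where H: "msupp m H" "F = meval m H" "msupp m H'" "G = meval m H'"
    using assms unfolding mpoly_fun_def by blast
  have "F X * G X = (\<Sum>\<alpha> | H \<alpha> \<noteq> 0. \<Sum>\<beta> | H' \<beta> \<noteq> 0.
      of_int (H \<alpha> * H' \<beta>) * (\<Prod>i\<le>m. X i ^ (\<alpha> i + \<beta> i)))" for X
    unfolding H meval_def sum_product
    by (intro sum.cong refl) (simp add: power_add prod.distrib mult_ac)
  moreover have "mpoly_fun m (\<lambda>X. of_int (H \<alpha> * H' \<beta>) * (\<Prod>i\<le>m. X i ^ (\<alpha> i + \<beta> i)) :: 'a)"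
    if "H \<alpha> \<noteq> 0" "H' \<beta> \<noteq> 0" for \<alpha> \<beta>
    using that H by (intro mpoly_fun_monomial) (auto simp: msupp_def MI_def)
  ultimately show ?thesis
    by (simp only:) (intro mpoly_fun_sum, simp)
qed

lemma mpoly_fun_diff_const:
  assumes "mpoly_fun m F"
  shows "mpoly_fun m (\<lambda>X. F X - of_int c)"
  using mpoly_fun_add[OF assms mpoly_fun_const[of m "- c"]] by simp

lemma mpoly_fun_prod:
  assumes "\<And>b. b \<in> B \<Longrightarrow> mpoly_fun m (F b)"
  shows "mpoly_fun m (\<lambda>X. \<Prod>b\<in>B. F b X)"
  using assms
proof (induction B rule: infinite_finite_induct)
  case (insert b B)
  then show ?case
    using mpoly_fun_mult[of m "F b"] by simp
qed (use mpoly_fun_const[of m 1] in simp_all)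

lemma mpoly_fun_pcompose:
  fixes P :: "int poly"
  assumes "mpoly_fun m F"
  shows "mpoly_fun m (\<lambda>X. pcompose P (F X))"
proof (induction P)
  case 0
  then show ?case
    using mpoly_fun_const[of m 0] by simp
next
  case (pCons c P)
  then show ?case
    using mpoly_fun_add[OF mpoly_fun_const[of m c] mpoly_fun_mult[OF assms pCons.IH]]
    by (simp add: pcompose_pCons of_int_poly)
qed

lemma poly_meval: "poly (meval m H X) z = meval m H (\<lambda>i. poly (X i) z)"
  by (simp add: meval_def poly_sum poly_prod)

lemma meval_dvd_diff:
  assumes "\<And>i. i \<le> m \<Longrightarrow> d dvd X i - Y i"
  shows "d dvd meval m H X - meval m H Y"
proof -
  have "d dvd of_int (H \<alpha>) * ((\<Prod>i\<le>m. X i ^ \<alpha> i) - (\<Prod>i\<le>m. Y i ^ \<alpha> i))" for \<alpha>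
    using assms by (intro dvd_mult prod_dvd_diff power_dvd_diff) auto
  then show ?thesis
    unfolding meval_def sum_subtractf[symmetric] right_diff_distrib[symmetric]
    by (intro dvd_sum)
qed

text \<open>By Fermat's little theorem, the product of the \<open>1 - (x\<^sub>i - \<delta>\<^sup>i b)\<^bsup>p-1\<^esup>\<close> for \<open>i < m\<close> is
  the characteristic function of \<open>b + p\<^sup>m Z\<^sub>p\<close> modulo \<open>p\<close>.\<close>
lemma mpoly_fun_mod_p:
  fixes D :: "int \<Rightarrow> nat \<Rightarrow> int poly" and P :: "int \<Rightarrow> int poly"
  assumes p: "prime p"
    and D: "\<And>x i. i \<le> m \<Longrightarrow> \<exists>G. D x i = of_int ((idelta p ^^ i) x)
      + of_int (p ^ (m - i)) * ([:0, 1:] + of_int p * G)"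
  shows "\<exists>H. msupp m H \<and> (\<forall>x\<in>{0..<p ^ m}. of_int p dvd meval m H (D x) - P x)"
proof -
  define e where "e = (\<lambda>i x. (idelta p ^^ i) x)"
  define I where "I = (\<lambda>b X. \<Prod>i<m. 1 - (X i - of_int (e i b)) ^ (nat p - 1) :: int poly)"
  \<comment> \<open>On the ball of \<open>b\<close>, \<open>X m - e m b\<close> is the coordinate
    \<open>z\<close> modulo \<open>p\<close>, so \<open>P b\<close> is composed with it; the factor
    \<open>I b\<close> removes the term modulo \<open>p\<close> on all other balls.\<close>
  define G where "G = (\<lambda>X. \<Sum>b\<in>{0..<p ^ m}. I b X * pcompose (P b) (X m - of_int (e m b)))"
  have pos: "nat p > 1"
    using p prime_gt_1_int by simp
  have "mpoly_fun m (\<lambda>X. 1 - (X i - of_int (e i b)) ^ (nat p - 1) :: int poly)" if "i < m" for i b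
  proof -
    \<comment> \<open>The power is written as a constant product so that closure under products
      covers it.\<close>
    have "mpoly_fun m (\<lambda>X. \<Prod>k<nat p - 1. X i - of_int (e i b) :: int poly)"
      using that by (intro mpoly_fun_prod mpoly_fun_diff_const mpoly_fun_var) simp
    then have "mpoly_fun m (\<lambda>X. of_int 1 + of_int (-1) * (X i - of_int (e i b)) ^ (nat p - 1) :: int poly)"
      by (intro mpoly_fun_add mpoly_fun_mult mpoly_fun_const) simp
    then show ?thesis by simp
  qed
  then have "mpoly_fun m G"
    unfolding G_def I_def
    by (intro mpoly_fun_sum mpoly_fun_mult mpoly_fun_prod mpoly_fun_pcompose
        mpoly_fun_diff_const mpoly_fun_var) auto
  then obtain H where H: "msupp m H" "G = meval m H"
    unfolding mpoly_fun_def by blast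
  have "of_int p dvd G (D x) - P x" if x: "x \<in> {0..<p ^ m}" for x
  proof -
    have digit: "of_int p dvd of_int (e i x) - D x i" if i: "i < m" for i
    proof -
      obtain K where K: "D x i = of_int (e i x) + of_int (p ^ (m - i)) * ([:0, 1:] + of_int p * K)"
        using D[of i x] i unfolding e_def by auto
      \<comment> \<open>The exponent \<open>m - i\<close> is positive, so \<open>D x i\<close> is
        constant modulo \<open>p\<close>.\<close>
      have "m - i = Suc (m - Suc i)"
        using i by simp
      then have "(of_int p :: int poly) dvd of_int (p ^ (m - i))"
        by simp
      with K show ?thesis
        by simp
    qed
    have factor: "of_int p dvd (1 - (D x i - of_int (e i b)) ^ (nat p - 1))
        - of_int (1 - (e i x - e i b) ^ (nat p - 1))" if "i < m" for i b
    proof -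
      have "of_int p dvd of_int (e i x - e i b) - (D x i - of_int (e i b))"
        using digit[OF that] by simp
      from power_dvd_diff[OF this, of "nat p - 1"] show ?thesis
        by simp
    qed
    have I: "of_int p dvd I b (D x) - of_int (\<Prod>i<m. 1 - (e i x - e i b) ^ (nat p - 1))" for b
      unfolding I_def of_int_prod using factor by (intro prod_dvd_diff) auto
    have I0: "of_int p dvd I b (D x)" if b: "b \<in> {0..<p ^ m}" "b \<noteq> x" for b
    proof -
      obtain i where i: "i < m" "\<not> p dvd e i x - e i b"
        using idelta_digits_eq[OF p _ x b(1)] b(2) unfolding e_def by blast
      then have "p dvd 1 - (e i x - e i b) ^ (nat p - 1)"
        by (intro fermat_int p)
      then have "p dvd (\<Prod>i<m. 1 - (e i x - e i b) ^ (nat p - 1))"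
        using i by (meson dvd_prodI dvd_trans finite_lessThan lessThan_iff)
      then have "(of_int p :: int poly) dvd of_int (\<Prod>i<m. 1 - (e i x - e i b) ^ (nat p - 1))"
        by (metis dvd_def of_int_mult)
      then show ?thesis
        using I[of b] by (metis dvd_diff_left_iff)
    qed
    \<comment> \<open>For \<open>b = x\<close> each factor is \<open>1 - 0 ^ (nat p - 1)\<close>,
      equal to \<open>1\<close> because the exponent is positive.\<close>
    have I1: "of_int p dvd I x (D x) - 1"
      using I[of x] pos by (simp add: power_0_left)
    \<comment> \<open>At \<open>i = m\<close> the power of \<open>p\<close> before \<open>z\<close>
      is \<open>p ^ 0\<close>, so the shifted iterate is \<open>z\<close> itself modulo
      \<open>p\<close>.\<close>
    obtain K where "D x m = of_int (e m x) + ([:0, 1:] + of_int p * K)"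
      using D[of m x] unfolding e_def by auto
    then have "of_int p dvd (D x m - of_int (e m x)) - [:0, 1:]"
      by simp
    from pcompose_dvd_diff[OF this, of "P x"]
    have Px: "of_int p dvd pcompose (P x) (D x m - of_int (e m x)) - P x"
      by simp
    have "G (D x) - P x = (\<Sum>b\<in>{0..<p ^ m} - {x}. I b (D x) * pcompose (P b) (D x m - of_int (e m b)))
        + ((I x (D x) - 1) * pcompose (P x) (D x m - of_int (e m x))
        + (pcompose (P x) (D x m - of_int (e m x)) - P x))"
      unfolding G_def using x by (subst sum.remove[of _ x]) (auto simp: algebra_simps)
    also have "of_int p dvd \<dots>"
      using I0 I1 Px by (intro dvd_add dvd_sum dvd_mult2) auto
    finally show ?thesis .
  qed
  with H show ?thesis by auto
qed


section \<open>Successive approximation and passage to the limit\<close>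

text \<open>At each stage the error is \<open>p ^ N\<close> times an integral family
  \<open>R\<close>; \<open>mpoly_fun_mod_p\<close> realises \<open>R\<close> modulo \<open>p\<close>
  by a polynomial \<open>K\<close>, and adding \<open>p ^ N * K\<close> gains one power of
  \<open>p\<close>. The target depends on \<open>N\<close> since a restricted series is a polynomial
  only modulo \<open>p ^ N\<close>.\<close>

lemma p_adic_approx:
  fixes D :: "int \<Rightarrow> nat \<Rightarrow> int poly" and P :: "nat \<Rightarrow> int \<Rightarrow> int poly"
  assumes p: "prime p"
    and D: "\<And>x i. i \<le> m \<Longrightarrow> \<exists>G. D x i = of_int ((idelta p ^^ i) x)
      + of_int (p ^ (m - i)) * ([:0, 1:] + of_int p * G)"
    and P: "\<And>N x. x \<in> {0..<p ^ m} \<Longrightarrow> of_int (p ^ N) dvd P (Suc N) x - P N x"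
  shows "\<exists>H. \<forall>N. (msupp m (H N) \<and>
      (\<forall>x\<in>{0..<p ^ m}. of_int (p ^ N) dvd P N x - meval m (H N) (D x))) \<and>
      (\<forall>\<alpha>. p ^ N dvd H (Suc N) \<alpha> - H N \<alpha>)"
proof (rule dependent_nat_choice)
  show "\<exists>H. msupp m H \<and> (\<forall>x\<in>{0..<p ^ m}. of_int (p ^ 0) dvd P 0 x - meval m H (D x))"
    by (rule exI[of _ "\<lambda>_. 0"]) (simp add: msupp_def)
next
  fix H N
  assume H: "msupp m H \<and> (\<forall>x\<in>{0..<p ^ m}. of_int (p ^ N) dvd P N x - meval m H (D x))"
  have "\<forall>x\<in>{0..<p ^ m}. \<exists>R. P (Suc N) x - meval m H (D x) = of_int (p ^ N) * R"
  proof
    fix x assume x: "x \<in> {0..<p ^ m}"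
    \<comment> \<open>Passing from \<open>P N\<close> to \<open>P (Suc N)\<close> moves the target
      by a multiple of \<open>p ^ N\<close>, so the error keeps that factor.\<close>
    have "of_int (p ^ N) dvd (P (Suc N) x - P N x) + (P N x - meval m H (D x))"
      using P[OF x] H x by (intro dvd_add) auto
    then show "\<exists>R. P (Suc N) x - meval m H (D x) = of_int (p ^ N) * R"
      by (simp add: dvd_def)
  qed
  then obtain R where R: "\<And>x. x \<in> {0..<p ^ m} \<Longrightarrow>
      P (Suc N) x - meval m H (D x) = of_int (p ^ N) * R x"
    by metis
  obtain K where K: "msupp m K" "\<And>x. x \<in> {0..<p ^ m} \<Longrightarrow> of_int p dvd meval m K (D x) - R x"
    using mpoly_fun_mod_p[OF p D, where P = R] by blast
  define H' where "H' = (\<lambda>\<alpha>. H \<alpha> + p ^ N * K \<alpha>)"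
  have "msupp m H'"
    unfolding H'_def using H K by (intro msupp_lin) auto
  moreover have "of_int (p ^ Suc N) dvd P (Suc N) x - meval m H' (D x)" if x: "x \<in> {0..<p ^ m}" for x
  proof -
    have "meval m H' (D x) = meval m H (D x) + of_int (p ^ N) * meval m K (D x)"
      unfolding H'_def using H K by (intro meval_lin) auto
    then have "P (Suc N) x - meval m H' (D x) = of_int (p ^ N) * (R x - meval m K (D x))"
      using R[OF x] by (simp add: algebra_simps)
    moreover have "of_int p dvd R x - meval m K (D x)"
      using K(2)[OF x] by (metis dvd_minus_iff minus_diff_eq)
    ultimately show ?thesis
      by (simp add: mult.commute mult_dvd_mono)
  qed
  moreover have "\<forall>\<alpha>. p ^ N dvd H' \<alpha> - H \<alpha>"
    by (simp add: H'_def)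
  ultimately show "\<exists>H'. (msupp m H' \<and>
      (\<forall>x\<in>{0..<p ^ m}. of_int (p ^ Suc N) dvd P (Suc N) x - meval m H' (D x))) \<and>
      (\<forall>\<alpha>. p ^ N dvd H' \<alpha> - H \<alpha>)"
    by blast
qed

text \<open>The congruences between successive \<open>H N\<close> make each coefficient a residue
  sequence. At level \<open>N\<close> only the finitely many exponents in the support of
  \<open>H N\<close> can survive, which gives the decay.\<close>

lemma restricted_limit:
  assumes p: "p > 0" and supp: "\<And>N. msupp m (H N)"
    and coh: "\<And>N \<alpha>. p ^ N dvd H (Suc N) \<alpha> - H N \<alpha>"
  shows "restricted p m (\<lambda>\<alpha> N. H N \<alpha> mod p ^ N)"
proof -
  have "H N \<alpha> mod p ^ N = H (Suc N) \<alpha> mod p ^ Suc N mod p ^ N" for N \<alpha>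
    using coh[of N \<alpha>] by (simp add: mod_mod_cancel mod_eq_dvd_iff dvd_diff_commute)
  then have zp: "(\<lambda>N. H N \<alpha> mod p ^ N) \<in> zp p" for \<alpha>
    unfolding zp_def using p pos_mod_bound pos_mod_sign zero_less_power by blast
  have "\<exists>d. \<forall>\<alpha>\<in>MI m. d \<le> (\<Sum>i\<le>m. \<alpha> i) \<longrightarrow> H N \<alpha> mod p ^ N = 0" for N
  proof -
    have "finite ((\<lambda>\<alpha>. \<Sum>i\<le>m. \<alpha> i) ` {\<alpha>. H N \<alpha> \<noteq> 0})"
      using supp by (simp add: msupp_def)
    then obtain d where d: "\<And>\<alpha>. H N \<alpha> \<noteq> 0 \<Longrightarrow> (\<Sum>i\<le>m. \<alpha> i) < d"
      unfolding finite_nat_set_iff_bounded by auto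
    then have "H N \<alpha> = 0" if "d \<le> (\<Sum>i\<le>m. \<alpha> i)" for \<alpha>
      using that by (metis not_le)
    then show ?thesis
      by (intro exI[of _ d]) auto
  qed
  with zp show ?thesis
    by (simp add: restricted_def)
qed

lemma ps_eval_limit:
  assumes "msupp m (H N)"
  shows "ps_eval p m (\<lambda>\<alpha> N. H N \<alpha> mod p ^ N) X N = meval m (H N) (\<lambda>i. X i N) mod p ^ N"
proof -
  \<comment> \<open>Nonzero coefficients divisible by \<open>p ^ N\<close> contribute zero terms, so
    the support of \<open>H N\<close> may serve as index set.\<close>
  have "(\<Sum>\<alpha> | \<alpha> \<in> MI m \<and> H N \<alpha> mod p ^ N \<noteq> 0. H N \<alpha> mod p ^ N * (\<Prod>i\<le>m. X i N ^ \<alpha> i))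
      = (\<Sum>\<alpha> | H N \<alpha> \<noteq> 0. H N \<alpha> mod p ^ N * (\<Prod>i\<le>m. X i N ^ \<alpha> i))"
    using assms unfolding msupp_def by (intro sum.mono_neutral_left) auto
  then have "ps_eval p m (\<lambda>\<alpha> N. H N \<alpha> mod p ^ N) X N
      = (\<Sum>\<alpha> | H N \<alpha> \<noteq> 0. H N \<alpha> mod p ^ N * (\<Prod>i\<le>m. X i N ^ \<alpha> i)) mod p ^ N"
    by (simp add: ps_eval_def)
  also have "\<dots> = (\<Sum>\<alpha> | H N \<alpha> \<noteq> 0. H N \<alpha> * (\<Prod>i\<le>m. X i N ^ \<alpha> i)) mod p ^ N"
    by (subst (1 2) mod_sum_eq[symmetric]) (simp add: mod_mult_left_eq)
  finally show ?thesis
    by (simp add: meval_def)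
qed

section \<open>Truncations of one-variable restricted series\<close>

text \<open>The reduction modulo \<open>p ^ N\<close>, lifted to integer coefficients. For
  restricted \<open>F\<close> the index set is finite by \<open>restricted_finite\<close>, so the
  default value of infinite sums does not intervene.\<close>

definition ps_trunc :: "((nat \<Rightarrow> nat) \<Rightarrow> nat \<Rightarrow> int) \<Rightarrow> nat \<Rightarrow> int poly" where
  "ps_trunc F N = (\<Sum>\<alpha> | \<alpha> \<in> MI 0 \<and> F \<alpha> N \<noteq> 0. monom (F \<alpha> N) (\<alpha> 0))"

lemma ps_eval_univariate: "ps_eval p 0 F (\<lambda>_. u) N = poly (ps_trunc F N) (u N) mod p ^ N"
  by (simp add: ps_eval_def ps_trunc_def poly_sum poly_monom)

lemma restricted_finite:
  assumes "restricted p 0 F"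
  shows "finite {\<alpha>. \<alpha> \<in> MI 0 \<and> F \<alpha> N \<noteq> 0}"
proof -
  have "\<exists>d. \<forall>\<alpha>\<in>MI 0. d \<le> \<alpha> 0 \<longrightarrow> F \<alpha> N = 0"
    using assms by (simp add: restricted_def)
  then obtain d where d: "\<And>\<alpha>. \<alpha> \<in> MI 0 \<Longrightarrow> d \<le> \<alpha> 0 \<Longrightarrow> F \<alpha> N = 0"
    by blast
  have "{\<alpha>. \<alpha> \<in> MI 0 \<and> F \<alpha> N \<noteq> 0} \<subseteq> (\<lambda>k i. if i = 0 then k else 0) ` {..<d}"
  proof
    fix \<alpha> assume \<alpha>: "\<alpha> \<in> {\<alpha>. \<alpha> \<in> MI 0 \<and> F \<alpha> N \<noteq> 0}"
    then have "\<alpha> = (\<lambda>i. if i = 0 then \<alpha> 0 else 0)"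
      by (auto simp: MI_def)
    moreover have "\<alpha> 0 \<in> {..<d}"
      using \<alpha> d[of \<alpha>] by (cases "\<alpha> 0 < d") auto
    ultimately show "\<alpha> \<in> (\<lambda>k i. if i = 0 then k else 0) ` {..<d}"
      by (rule image_eqI)
  qed
  then show ?thesis
    by (rule finite_subset) simp
qed

lemma ps_trunc_coherent:
  assumes F: "restricted p 0 F"
  shows "of_int (p ^ N) dvd ps_trunc F (Suc N) - ps_trunc F N"
proof -
  let ?S = "{\<alpha>. \<alpha> \<in> MI 0 \<and> F \<alpha> (Suc N) \<noteq> 0}"
  have coh: "F \<alpha> (Suc N) mod p ^ N = F \<alpha> N" if "\<alpha> \<in> MI 0" for \<alpha>
    using F that zp_Suc unfolding restricted_def by blast
  \<comment> \<open>A coefficient nonzero at level \<open>N\<close> is nonzero at level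
    \<open>Suc N\<close>, so both truncations can be summed over the larger set.\<close>
  have "ps_trunc F N = (\<Sum>\<alpha>\<in>?S. monom (F \<alpha> N) (\<alpha> 0))"
    unfolding ps_trunc_def
  proof (rule sum.mono_neutral_left)
    show "{\<alpha>. \<alpha> \<in> MI 0 \<and> F \<alpha> N \<noteq> 0} \<subseteq> ?S"
      using coh by force
  qed (use restricted_finite[OF F] in auto)
  then have "ps_trunc F (Suc N) - ps_trunc F N = (\<Sum>\<alpha>\<in>?S. monom (F \<alpha> (Suc N) - F \<alpha> N) (\<alpha> 0))"
    by (simp add: ps_trunc_def[of _ "Suc N"] diff_monom flip: sum_subtractf)
  moreover have "of_int (p ^ N) dvd monom (F \<alpha> (Suc N) - F \<alpha> N) (\<alpha> 0)" if "\<alpha> \<in> ?S" for \<alpha>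
  proof -
    have "p ^ N dvd F \<alpha> (Suc N) - F \<alpha> N"
      using coh[of \<alpha>] that by (metis (lifting) dvd_minus_mod mem_Collect_eq)
    then obtain k where "F \<alpha> (Suc N) - F \<alpha> N = p ^ N * k" ..
    then have "monom (F \<alpha> (Suc N) - F \<alpha> N) (\<alpha> 0) = of_int (p ^ N) * monom k (\<alpha> 0)"
      unfolding of_int_poly by (simp add: smult_monom)
    then show ?thesis
      by simp
  qed
  ultimately show ?thesis
    by (simp only:) (rule dvd_sum)
qed

section \<open>Decomposition into balls and the conclusion\<close>

text \<open>The ball containing \<open>a\<close> is centred at the integer \<open>a m\<close>.
  Division by \<open>p ^ m\<close> uses up \<open>m\<close> digits, so level \<open>N\<close> of the
  coordinate \<open>u\<close> comes from level \<open>N + m\<close> of \<open>a\<close>.\<close>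

lemma zp_split:
  fixes p :: int and m :: nat
  assumes p: "p > 0" and a: "a \<in> zp p"
  defines "u \<equiv> \<lambda>N. a (N + m) div p ^ m"
  shows "u \<in> zp p" and "a = zadd p (zof p (a m)) (zmul p (zpow p (zof p p) m) u)"
    and "a (N + m) = a m + p ^ m * u N"
proof -
  have split: "a (N + m) = a m + p ^ m * u N" for N
  proof -
    have "a (N + m) mod p ^ m = a m"
      using zp_mod[OF a, of m N] by (metis add.commute)
    then show ?thesis
      using mult_div_mod_eq[of "p ^ m" "a (N + m)"] unfolding u_def by linarith
  qed
  have "0 \<le> u N \<and> u N < p ^ N" for N
  proof -
    have "0 \<le> u N"
      using p zp_range[OF a, of "N + m"] by (simp add: u_def pos_imp_zdiv_nonneg_iff)
    moreover have "p ^ m * u N < p ^ m * p ^ N"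
      using split[of N] zp_range(1)[OF a, of m] zp_range(2)[OF a, of "N + m"]
      unfolding power_add by (simp add: mult.commute)
    ultimately show ?thesis
      using p by simp
  qed
  moreover have "u N = u (Suc N) mod p ^ N" for N
  proof -
    have "p ^ m * (u (Suc N) - u N) = a (Suc (N + m)) - a (N + m)"
      using split[of "Suc N"] split[of N] by (simp add: algebra_simps)
    moreover have "p ^ (N + m) dvd a (Suc (N + m)) - a (N + m)"
      using zp_dvd_diff[OF a, of "N + m" 1] by simp
    ultimately have "p ^ m * p ^ N dvd p ^ m * (u (Suc N) - u N)"
      by (simp only: power_add mult.commute[of "p ^ N"])
    then have "p ^ N dvd u (Suc N) - u N"
      using p by (simp only: dvd_mult_cancel_left) simp
    then have "u (Suc N) mod p ^ N = u N mod p ^ N"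
      by (simp add: mod_eq_dvd_iff)
    then show ?thesis
      using \<open>0 \<le> u N \<and> u N < p ^ N\<close> by simp
  qed
  ultimately show "u \<in> zp p"
    by (rule zpI)
  show "a = zadd p (zof p (a m)) (zmul p (zpow p (zof p p) m) u)"
  proof
    fix N
    have "a N = (a m + p ^ m * u N) mod p ^ N"
      using zp_mod[OF a, of N m] split[of N] by simp
    then show "a N = zadd p (zof p (a m)) (zmul p (zpow p (zof p p) m) u) N"
      by (simp add: zadd_def zof_def zmul_def zpow_def mod_simps)
  qed
  show "a (N + m) = a m + p ^ m * u N"
    by (rule split)
qed

theorem theorem1p5:
  fixes p :: int and m :: nat and f :: "(nat \<Rightarrow> int) \<Rightarrow> (nat \<Rightarrow> int)"
  assumes "prime p"
    and "\<forall>a\<in>zp p. f a \<in> zp p"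
    and "analytic_level p m f"
  shows "arith_diff_op p m f"
proof -
  note p = \<open>prime p\<close>
  have pos: "p > 0"
    using p prime_gt_0_int by blast
  have "\<forall>x i. \<exists>Y. i \<le> m \<longrightarrow> (\<forall>z. poly Y z = (idelta p ^^ i) (x + p ^ m * z)) \<and>
      (\<exists>G. Y = of_int ((idelta p ^^ i) x) + of_int (p ^ (m - i)) * ([:0, 1:] + of_int p * G))"
    using idelta_poly[OF p] by meson
  then obtain D :: "int \<Rightarrow> nat \<Rightarrow> int poly"
    where D: "\<And>x i z. i \<le> m \<Longrightarrow> poly (D x i) z = (idelta p ^^ i) (x + p ^ m * z)"
      and D': "\<And>x i. i \<le> m \<Longrightarrow> \<exists>G. D x i = of_int ((idelta p ^^ i) x)
        + of_int (p ^ (m - i)) * ([:0, 1:] + of_int p * G)"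
    by metis
  have "zof p x \<in> zp p" for x
    using pos by (simp add: zp_def zof_def mod_mod_cancel)
  \<comment> \<open>Every ball contains an integer, so one local expansion per integer centre covers
    all of \<open>zp p\<close>.\<close>
  then have "\<forall>x. \<exists>\<Phi>. restricted p 0 \<Phi> \<and> (\<forall>u\<in>zp p.
      f (zadd p (zof p x) (zmul p (zpow p (zof p p) m) u)) = ps_eval p 0 \<Phi> (\<lambda>_. u))"
    using assms(3) unfolding analytic_level_def by blast
  from choice[OF this] obtain \<Phi> where "\<forall>x. restricted p 0 (\<Phi> x) \<and> (\<forall>u\<in>zp p.
      f (zadd p (zof p x) (zmul p (zpow p (zof p p) m) u)) = ps_eval p 0 (\<Phi> x) (\<lambda>_. u))" ..
  then have \<Phi>: "restricted p 0 (\<Phi> x)"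
    and f: "u \<in> zp p \<Longrightarrow> f (zadd p (zof p x) (zmul p (zpow p (zof p p) m) u)) = ps_eval p 0 (\<Phi> x) (\<lambda>_. u)"
    for x u
    by blast+
  \<comment> \<open>The targets of the approximation are the local series, cut off modulo
    \<open>p ^ N\<close>.\<close>
  define P where "P = (\<lambda>N x. ps_trunc (\<Phi> x) N)"
  have "of_int (p ^ N) dvd P (Suc N) x - P N x" for N x
    unfolding P_def by (rule ps_trunc_coherent[OF \<Phi>])
  from p_adic_approx[where P = P and D = D, OF p D' this]
  obtain H where H: "\<forall>N. (msupp m (H N) \<and>
      (\<forall>x\<in>{0..<p ^ m}. of_int (p ^ N) dvd P N x - meval m (H N) (D x))) \<and>
      (\<forall>\<alpha>. p ^ N dvd H (Suc N) \<alpha> - H N \<alpha>)"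
    by blast
  then have supp: "msupp m (H N)"
    and HP: "x \<in> {0..<p ^ m} \<Longrightarrow> of_int (p ^ N) dvd P N x - meval m (H N) (D x)"
    and coh: "p ^ N dvd H (Suc N) \<alpha> - H N \<alpha>" for N x \<alpha>
    by blast+
  define F where "F = (\<lambda>\<alpha> N. H N \<alpha> mod p ^ N)"
  have "f a = ps_eval p m F (\<lambda>i. (fdelta p ^^ i) a)" if a: "a \<in> zp p" for a
  proof
    fix N
    define x where "x = a m"
    define u where "u = (\<lambda>N. a (N + m) div p ^ m)"
    have u: "u \<in> zp p" and a_eq: "a = zadd p (zof p x) (zmul p (zpow p (zof p p) m) u)"
      and split: "a (N + m) = x + p ^ m * u N"
      unfolding u_def x_def by (rule zp_split[OF pos a, where m = m])+
    have x: "x \<in> {0..<p ^ m}"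
      using zp_range[OF a, of m] by (simp add: x_def)
    have "p ^ N dvd (fdelta p ^^ i) a N - poly (D x i) (u N)" if i: "i \<le> m" for i
    proof -
      \<comment> \<open>The \<open>i\<close>-th iterate modulo \<open>p ^ N\<close> depends on
        \<open>a\<close> modulo \<open>p ^ (N + i)\<close>; as \<open>i \<le> m\<close>, the single
        integer \<open>a (N + m) = x + p ^ m * u N\<close> serves for all \<open>i\<close>.\<close>
      have "p ^ (N + i) dvd a (N + i) - a (N + m)"
        using zp_dvd_diff[OF a, of "N + i" "m - i"] i by (simp add: dvd_diff_commute)
      then have "p ^ N dvd (idelta p ^^ i) (a (N + i)) - (idelta p ^^ i) (a (N + m))"
        by (rule idelta_funpow_dvd_diff[OF p])
      then have "p ^ N dvd ((fdelta p ^^ i) a N - (idelta p ^^ i) (a (N + i)))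
          + ((idelta p ^^ i) (a (N + i)) - (idelta p ^^ i) (a (N + m)))"
        using fdelta_funpow[OF p a] by (intro dvd_add) auto
      then show ?thesis
        using D[OF i] split by simp
    qed
    then have "p ^ N dvd meval m (H N) (\<lambda>i. (fdelta p ^^ i) a N) - meval m (H N) (\<lambda>i. poly (D x i) (u N))"
      by (rule meval_dvd_diff)
    \<comment> \<open>By \<open>poly_meval\<close> the values at \<open>u N\<close> can be taken
      after substituting \<open>D x\<close> into \<open>H N\<close>; there the coefficientwise
      congruence \<open>HP\<close> applies.\<close>
    then have "ps_eval p m F (\<lambda>i. (fdelta p ^^ i) a) N = poly (meval m (H N) (D x)) (u N) mod p ^ N"
      unfolding F_def ps_eval_limit[OF supp] poly_meval by (simp add: mod_eq_dvd_iff)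
    also have "\<dots> = poly (P N x) (u N) mod p ^ N"
      using poly_dvd_of_int[OF HP[OF x], of N "u N"] by (simp add: mod_eq_dvd_iff dvd_diff_commute)
    also have "\<dots> = ps_eval p 0 (\<Phi> x) (\<lambda>_. u) N"
      by (simp add: P_def ps_eval_univariate)
    also have "\<dots> = f a N"
      unfolding f[OF u, symmetric] a_eq[symmetric] ..
    finally show "f a N = ps_eval p m F (\<lambda>i. (fdelta p ^^ i) a) N" ..
  qed
  moreover have "restricted p m F"
    unfolding F_def using restricted_limit[OF pos] supp coh by blast
  ultimately show ?thesis
    unfolding arith_diff_op_def by blast
qed

end
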